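(* Let $\alpha\le 0$ and $\beta\ge 0$ be real numbers, and let $f\in\mathcal{A}$ satisfy $f(z)f'(z)/z\neq 0$ for all $z\in\mathbb{D}$. If at least one of the following inequalities holds for all $z\in\mathbb{D}$: (i) $\operatorname{Re}\left(\alpha\dfrac{Q_{SD}}{Q_{ST}}+Q_{ST}(1+\beta Q_{CV})\right)>-\dfrac{\beta}{2}$; (ii) $\operatorname{Re}\left(\alpha\dfrac{Q_{SD}}{Q_{ST}}+Q_{CV}(1+\beta Q_{ST})\right)>-\dfrac{\beta}{2}$; (iii) $\operatorname{Re}\left(\alpha\dfrac{Q_{SD}}{Q_{CV}}+Q_{CV}(1+\beta Q_{ST})\right)>-\dfrac{\beta}{2}$; (iv) $\operatorname{Re}\left(\alpha\dfrac{Q_{SD}}{Q_{CV}}+Q_{ST}(1+\beta Q_{CV})\right)>-\dfrac{\beta}{2}$; then $f$ is starlike.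
   Context: $\mathbb{D}=\{z\in\mathbb{C}:|z|<1\}$. $\mathcal{A}$ is the class of analytic functions $f:\mathbb{D}\to\mathbb{C}$ with $f(0)=0$ and $f'(0)=1$. For $f\in\mathcal{A}$, as functions of $z\in\mathbb{D}$: $Q_{ST}=zf'(z)/f(z)$ (with the removable singularity at $z=0$ filled in, value $1$), $Q_{CV}=1+zf''(z)/f'(z)$, and $Q_{SD}=z^2\Big(\big(f''(z)/f'(z)\big)'-\tfrac12\big(f''(z)/f'(z)\big)^2\Big)$ ($z^2$ times the Schwarzian derivative of $f$). The condition $f(z)f'(z)/z\neq0$ is understood at $z=0$ via the removable singularity (where the value is $1$). An inequality containing a quotient is understood to include the requirement that the denominators appearing in it do not vanish in $\mathbb{D}$. A function $f\in\mathcal{A}$ is starlike if $\operatorname{Re}Q_{ST}>0$ on $\mathbb{D}$; equivalently, $f$ is univalent and $tf(z)\in f(\mathbb{D})$ for all $z\in\mathbb{D}$, $t\in[0,1]$. *)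

theory Defs
  imports "HOL-Complex_Analysis.Complex_Analysis"
begin

abbreviation unit_disc :: "complex set" where
  "unit_disc \<equiv> ball 0 1"

definition class_A :: "(complex \<Rightarrow> complex) set" where
  "class_A = {f. f holomorphic_on unit_disc \<and> f 0 = 0 \<and> deriv f 0 = 1}"

(* For f in class_A the quotients z f'(z) / f(z) and f(z) f'(z) / z have a removable
   singularity at 0, with limit f'(0) = 1 and f'(0)^2 = 1 respectively. *)

definition Q_ST :: "(complex \<Rightarrow> complex) \<Rightarrow> complex \<Rightarrow> complex" where
  "Q_ST f z = (if z = 0 then 1 else z * deriv f z / f z)"

definition f_f'_over_z :: "(complex \<Rightarrow> complex) \<Rightarrow> complex \<Rightarrow> complex" where
  "f_f'_over_z f z = (if z = 0 then 1 else f z * deriv f z / z)"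

definition Q_CV :: "(complex \<Rightarrow> complex) \<Rightarrow> complex \<Rightarrow> complex" where
  "Q_CV f z = 1 + z * deriv (deriv f) z / deriv f z"

definition Q_SD :: "(complex \<Rightarrow> complex) \<Rightarrow> complex \<Rightarrow> complex" where
  "Q_SD f z = z\<^sup>2 * (deriv (\<lambda>w. deriv (deriv f) w / deriv f w) z
                   - 1 / 2 * (deriv (deriv f) z / deriv f z)\<^sup>2)"

(* The inequality also forces f(z) \<noteq> 0 for z \<noteq> 0, because x / 0 = 0 in HOL.
   The constant starlike of HOL-Analysis is a different notion: it is about sets. *)
definition starlike_function :: "(complex \<Rightarrow> complex) \<Rightarrow> bool" where
  "starlike_function f \<longleftrightarrow> f \<in> class_A \<and> (\<forall>z\<in>unit_disc. Re (Q_ST f z) > 0)"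

end

theory Submission
  imports Defs
begin

text \<open>
  Write \<open>p = z f' / f\<close>, so that starlikeness says \<open>Re p > 0\<close> on the disc. The proof looks at the
  first moment at which this fails: as \<open>p 0 = 1\<close>, if \<open>Re p\<close> is somewhere nonpositive, then there is a
  point \<open>z\<close> of least modulus with \<open>Re (p z) = 0\<close> (lemma \<open>first_boundary_contact\<close>). Let
  \<open>Y = z p' z\<close> and \<open>V = z p' z + z\<^sup>2 p'' z\<close>. Three things are known at such a contact point.

  Along the circle through \<open>z\<close> the function \<open>Re p\<close> is minimal at \<open>z\<close>; its first derivative in the
  argument being zero says that \<open>Y\<close> is real, and its second derivative being nonnegative says that
  \<open>Re V \<le> 0\<close> (lemma \<open>Re_minimal_on_circle\<close>). Inside the circle \<open>p\<close> has positive real part, so the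
  Schwarz lemma bounds \<open>Re p\<close> from below along the radius; comparing derivatives at the end of the radius
  gives \<open>Y \<le> - (1 + \<bar>p z\<bar>\<^sup>2) / 2\<close> (lemma \<open>radial_derivative_at_contact\<close>).

  Now \<open>Q_CV = p + z p' / p\<close>. With \<open>p z = \<i> x\<close>, this makes \<open>Q_CV\<close> purely imaginary at \<open>z\<close>, and
  \<open>Q_ST \<cdot> Q_CV = Y - x\<^sup>2 \<le> - 1 / 2\<close>. Hence \<open>Q_ST (1 + \<beta> Q_CV)\<close> and \<open>Q_CV (1 + \<beta> Q_ST)\<close> both have
  real part at most \<open>- \<beta> / 2\<close>. Moreover \<open>Q_SD = z Q_CV' + (1 - Q_CV\<^sup>2) / 2\<close>, which at \<open>z\<close> is a real
  number plus \<open>V / p\<close>. Dividing the real number by the imaginary \<open>Q_ST\<close> or \<open>Q_CV\<close> leaves no real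
  part, and dividing \<open>V / p\<close> leaves \<open>V\<close> over the negative number \<open>p\<^sup>2\<close> or \<open>p Q_CV\<close>, which has
  nonnegative real part. As \<open>\<alpha> \<le> 0\<close>, the Schwarzian term does not increase the real part, and each of the
  four inequalities fails at \<open>z\<close>.
\<close>

section \<open>Minimal real part on a circle\<close>

lemma second_derivative_nonneg_at_min:
  fixes h h' :: "real \<Rightarrow> real"
  assumes h: "\<And>t. (h has_real_derivative h' t) (at t)"
    and h': "(h' has_real_derivative c) (at a)"
    and min: "\<And>t. h a \<le> h t"
  shows "h' a = 0" and "0 \<le> c"
proof -
  show h'0: "h' a = 0"
    using DERIV_local_min[OF h, of 1 a] min by simp
  show "0 \<le> c"
  proof (rule ccontr)
    assume "\<not> 0 \<le> c"
    then obtain d where d: "d > 0" "\<And>s. 0 < s \<Longrightarrow> s < d \<Longrightarrow> h' (a + s) < h' a"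
      using DERIV_neg_dec_right[OF h'] by auto
    obtain t where t: "a < t" "t < a + d / 2" "h (a + d / 2) - h a = (a + d / 2 - a) * h' t"
      using MVT2[of a "a + d / 2" h h'] h d(1) by auto
    have "h' t < 0"
      using d(2)[of "t - a"] t d(1) h'0 by simp
    then have "h (a + d / 2) < h a"
      using t(3) d(1) mult_pos_neg[of "d / 2" "h' t"] by simp
    with min[of "a + d / 2"] show False by simp
  qed
qed

text \<open>
  Chain rule for a complex differentiable \<open>p\<close> along a path, read off in real coordinates. It serves both the
  circle and the radius through a contact point.
\<close>
lemma has_real_derivative_Re_along_path:
  assumes "(\<gamma> has_vector_derivative v) (at t)"
    and "(p has_field_derivative d) (at (\<gamma> t))"
  shows "((\<lambda>s. Re (p (\<gamma> s))) has_real_derivative Re (v * d)) (at t)"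
    and "((\<lambda>s. Im (p (\<gamma> s))) has_real_derivative Im (v * d)) (at t)"
proof -
  have "((\<lambda>s. p (\<gamma> s)) has_vector_derivative v * d) (at t)"
    using field_vector_diff_chain_at[OF assms] by (simp add: o_def)
  then show "((\<lambda>s. Re (p (\<gamma> s))) has_real_derivative Re (v * d)) (at t)"
    and "((\<lambda>s. Im (p (\<gamma> s))) has_real_derivative Im (v * d)) (at t)"
    unfolding has_real_derivative_iff_has_vector_derivative
    by (rule bounded_linear.has_vector_derivative[OF bounded_linear_Re],
        rule bounded_linear.has_vector_derivative[OF bounded_linear_Im])
qed

text \<open>
  For \<open>h t = Re (p (z\<^sub>0 e\<^bsup>\<i>t\<^esup>))\<close> one has \<open>h' 0 = - Im (z\<^sub>0 p' z\<^sub>0)\<close> and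
  \<open>h'' 0 = - Re (z\<^sub>0 p' z\<^sub>0 + z\<^sub>0\<^sup>2 p'' z\<^sub>0)\<close>, so the two claims are the first and second order
  conditions for a minimum.
\<close>
lemma Re_minimal_on_circle:
  assumes hol: "p holomorphic_on S" and S: "open S" "sphere 0 (norm z\<^sub>0) \<subseteq> S"
    and min: "\<And>z. norm z = norm z\<^sub>0 \<Longrightarrow> Re (p z\<^sub>0) \<le> Re (p z)"
  shows "Im (z\<^sub>0 * deriv p z\<^sub>0) = 0"
    and "Re (z\<^sub>0 * deriv p z\<^sub>0 + z\<^sub>0\<^sup>2 * deriv (deriv p) z\<^sub>0) \<le> 0"
proof -
  define \<gamma> where "\<gamma> = (\<lambda>t. z\<^sub>0 * cis t)"
  have norm_\<gamma>: "norm (\<gamma> t) = norm z\<^sub>0" for t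
    by (simp add: \<gamma>_def norm_mult)
  have \<gamma>_S: "\<gamma> t \<in> S" for t
    using S(2) norm_\<gamma> by (auto simp: subset_iff)
  have \<gamma>': "(\<gamma> has_vector_derivative \<i> * \<gamma> t) (at t)" for t
    unfolding \<gamma>_def cis_conv_exp
    by (rule has_vector_derivative_eq_rhs, (rule derivative_intros has_vector_derivative_real_field)+)
       (auto intro!: derivative_eq_intros)
  have p': "(p has_field_derivative deriv p z) (at z)" if "z \<in> S" for z
    using hol S(1) that by (rule holomorphic_derivI)
  have p'': "(deriv p has_field_derivative deriv (deriv p) z) (at z)" if "z \<in> S" for z
    using holomorphic_deriv[OF hol S(1)] S(1) that by (rule holomorphic_derivI)
  define h where "h = (\<lambda>t. Re (p (\<gamma> t)))"
  define h' where "h' = (\<lambda>t. - Im (\<gamma> t * deriv p (\<gamma> t)))"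
  have h: "(h has_real_derivative h' t) (at t)" for t
    using has_real_derivative_Re_along_path(1)[OF \<gamma>' p'[OF \<gamma>_S]] by (simp add: h_def h'_def mult.assoc)
  have zp': "((\<lambda>z. z * deriv p z) has_field_derivative deriv p z + z * deriv (deriv p) z) (at z)"
    if "z \<in> S" for z
    by (rule derivative_eq_intros p''[OF that] refl)+ simp
  have h': "(h' has_real_derivative - Re (\<gamma> 0 * (deriv p (\<gamma> 0) + \<gamma> 0 * deriv (deriv p) (\<gamma> 0)))) (at 0)"
    using DERIV_minus[OF has_real_derivative_Re_along_path(2)[OF \<gamma>'[of 0] zp'[OF \<gamma>_S]]]
    by (simp add: h'_def mult.assoc)
  have "h 0 \<le> h t" for t
    using min[OF norm_\<gamma>] by (simp add: h_def \<gamma>_def)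
  from second_derivative_nonneg_at_min[OF h h' this]
  show "Im (z\<^sub>0 * deriv p z\<^sub>0) = 0"
    and "Re (z\<^sub>0 * deriv p z\<^sub>0 + z\<^sub>0\<^sup>2 * deriv (deriv p) z\<^sub>0) \<le> 0"
    by (simp_all add: h'_def \<gamma>_def power2_eq_square algebra_simps)
qed

section \<open>Functions with positive real part and their first boundary contact\<close>

text \<open>
  Quantitative form of the fact that \<open>w \<mapsto> (1 - w) / (1 + w)\<close> maps the right half-plane to the disc.
\<close>
lemma four_Re_eq_norm_difference:
  "4 * Re w = (norm (1 + w))\<^sup>2 - (norm (1 - w))\<^sup>2"
  unfolding cmod_power2 by (simp add: power2_eq_square algebra_simps)

text \<open>
  The Schwarz lemma, applied to the Cayley transform \<open>(1 - p) / (1 + p)\<close> after scaling the disc of radius \<open>r\<close>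
  to the unit disc. The factor \<open>\<bar>1 + p z\<bar>\<^sup>2\<close> is kept because at a contact point it becomes the bound
  \<open>1 + \<bar>p z\<bar>\<^sup>2\<close> of lemma \<open>radial_derivative_at_contact\<close>.
\<close>
lemma positive_real_part_lower_bound:
  assumes hol: "p holomorphic_on ball 0 r" and p0: "p 0 = 1"
    and pos: "\<And>z. norm z < r \<Longrightarrow> 0 < Re (p z)"
    and \<rho>: "0 \<le> \<rho>" "\<rho> < 1" and z: "norm z = \<rho> * r" and r: "0 < r"
  shows "(1 - \<rho>\<^sup>2) * (norm (1 + p z))\<^sup>2 \<le> 4 * Re (p z)"
proof -
  define w where "w = (\<lambda>\<zeta>. (1 - p (of_real r * \<zeta>)) / (1 + p (of_real r * \<zeta>)))"
  have ne: "1 + p \<zeta> \<noteq> 0" if "norm \<zeta> < r" for \<zeta>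
    using pos[OF that] by (auto simp: complex_eq_iff)
  have scale: "norm (of_real r * \<zeta>) < r" if "norm \<zeta> < 1" for \<zeta> :: complex
    using that r by (simp add: norm_mult)
  have hol_scaled: "(\<lambda>\<zeta>. p (of_real r * \<zeta>)) holomorphic_on ball 0 1"
    using holomorphic_on_compose_gen[OF _ hol, of "\<lambda>\<zeta>. of_real r * \<zeta>" "ball 0 1"] scale
    by (simp add: o_def image_subset_iff holomorphic_intros)
  have "w holomorphic_on ball 0 1"
    unfolding w_def using ne scale by (intro holomorphic_intros hol_scaled) auto
  moreover have "w 0 = 0"
    by (simp add: w_def p0)
  moreover have "norm (w \<zeta>) < 1" if "norm \<zeta> < 1" for \<zeta>
  proof -
    let ?q = "p (of_real r * \<zeta>)"
    have "(norm (1 - ?q))\<^sup>2 < (norm (1 + ?q))\<^sup>2"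
      using four_Re_eq_norm_difference[of ?q] pos[OF scale[OF that]] by simp
    then have "norm (1 - ?q) < norm (1 + ?q)"
      by (rule power2_less_imp_less) simp
    then show ?thesis
      using ne[OF scale[OF that]] by (simp add: w_def norm_divide)
  qed
  moreover have nz: "norm (z / of_real r) = \<rho>"
    using z r by (simp add: norm_divide)
  ultimately have "norm (w (z / of_real r)) \<le> \<rho>"
    using Schwarz_Lemma(1)[of w "z / of_real r"] \<rho> by simp
  moreover have "1 + p z \<noteq> 0"
    using ne z \<rho> r by simp
  ultimately have "norm (1 - p z) \<le> \<rho> * norm (1 + p z)"
    using r by (simp add: w_def norm_divide divide_le_eq)
  then have "(norm (1 - p z))\<^sup>2 \<le> \<rho>\<^sup>2 * (norm (1 + p z))\<^sup>2"
    unfolding power_mult_distrib[symmetric] by (rule power_mono) simp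
  then show ?thesis
    using four_Re_eq_norm_difference[of "p z"] by (simp add: algebra_simps)
qed

text \<open>
  The points of a closed disc at which \<open>Re p \<le> 0\<close> form a compact set; one of least modulus is taken.
  Inside its circle \<open>Re p\<close> is positive, hence by continuity nonnegative on the circle.
\<close>
lemma first_boundary_contact:
  assumes hol: "p holomorphic_on ball 0 1" and p0: "p 0 = 1"
    and z\<^sub>1: "norm z\<^sub>1 < 1" "Re (p z\<^sub>1) \<le> 0"
  obtains z where "norm z < 1" and "z \<noteq> 0" and "Re (p z) = 0"
    and "\<And>\<zeta>. norm \<zeta> < norm z \<Longrightarrow> 0 < Re (p \<zeta>)"
    and "\<And>\<zeta>. norm \<zeta> = norm z \<Longrightarrow> 0 \<le> Re (p \<zeta>)"
proof -
  define K where "K = cball 0 (norm z\<^sub>1) \<inter> {z. Re (p z) \<le> 0}"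
  have cont: "continuous_on (ball 0 1) (\<lambda>z. Re (p z))"
    by (intro continuous_intros holomorphic_on_imp_continuous_on hol)
  have sub: "cball 0 (norm z\<^sub>1) \<subseteq> ball (0::complex) 1"
    using z\<^sub>1 by auto
  have "closed (cball 0 (norm z\<^sub>1) \<inter> (\<lambda>z. Re (p z)) -` {..0})"
    by (rule continuous_closed_preimage) (use cont sub in \<open>auto intro: continuous_on_subset\<close>)
  then have "closed K"
    by (simp add: K_def vimage_def)
  then have "compact K"
    by (intro compact_eq_bounded_closed[THEN iffD2] conjI bounded_subset[OF bounded_cball])
       (auto simp: K_def)
  moreover have "K \<noteq> {}"
    using z\<^sub>1 by (auto simp: K_def)
  ultimately obtain z where z: "z \<in> K" and min: "\<And>\<zeta>. \<zeta> \<in> K \<Longrightarrow> norm z \<le> norm \<zeta>"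
    using continuous_attains_inf[of K norm] by (auto intro: continuous_intros)
  have z1: "norm z < 1" and "Re (p z) \<le> 0"
    using z z\<^sub>1 by (auto simp: K_def)
  then have "z \<noteq> 0"
    using p0 by auto
  have pos: "0 < Re (p \<zeta>)" if "norm \<zeta> < norm z" for \<zeta>
    using min[of \<zeta>] that z by (force simp: K_def)
  have nonneg: "0 \<le> Re (p \<zeta>)" if "norm \<zeta> = norm z" for \<zeta>
  proof -
    have cl: "closure (ball 0 (norm z)) = cball (0::complex) (norm z)"
      using \<open>z \<noteq> 0\<close> by simp
    have "continuous_on (closure (ball 0 (norm z))) (\<lambda>z. Re (p z))"
      unfolding cl using z1 by (intro continuous_on_subset[OF cont]) auto
    then show ?thesis
      by (rule continuous_ge_on_closure) (use that pos cl in \<open>auto simp: less_imp_le\<close>)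
  qed
  show thesis
    using that[OF z1 \<open>z \<noteq> 0\<close> _ pos nonneg] nonneg[of z] \<open>Re (p z) \<le> 0\<close> by simp
qed

text \<open>
  The difference \<open>\<phi>\<close> of the two sides of \<open>positive_real_part_lower_bound\<close> along the radius is nonnegative
  before the contact point and zero there, so its derivative at the contact point is not positive. This
  is the bound that the Jack--Miller--Mocanu lemma gives, obtained here for the real part directly.
\<close>
lemma radial_derivative_at_contact:
  assumes hol: "p holomorphic_on ball 0 1" and p0: "p 0 = 1"
    and z: "norm z < 1" "z \<noteq> 0" "Re (p z) = 0"
    and pos: "\<And>\<zeta>. norm \<zeta> < norm z \<Longrightarrow> 0 < Re (p \<zeta>)"
  shows "2 * Re (z * deriv p z) \<le> - (1 + (norm (p z))\<^sup>2)"
proof -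
  \<comment> \<open>The squared norm is expanded into real and imaginary parts to make it differentiable termwise.\<close>
  define \<phi> where "\<phi> = (\<lambda>t. 4 * Re (p (of_real t * z)) - (1 - t\<^sup>2) *
      ((1 + Re (p (of_real t * z)))\<^sup>2 + (Im (p (of_real t * z)))\<^sup>2))"
  have p': "(p has_field_derivative deriv p z) (at (of_real 1 * z))"
    using holomorphic_derivI[OF hol open_ball] z by simp
  have \<gamma>: "((\<lambda>t. of_real t * z) has_vector_derivative z) (at 1)"
    by (auto intro!: derivative_eq_intros)
  note [derivative_intros] = has_real_derivative_Re_along_path[OF \<gamma> p']
  have \<phi>': "(\<phi> has_real_derivative 4 * Re (z * deriv p z) + 2 * (1 + (Im (p z))\<^sup>2)) (at 1)"
    unfolding \<phi>_def using z(3) by (auto intro!: derivative_eq_intros)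
  have \<phi>1: "\<phi> 1 = 0"
    using z by (simp add: \<phi>_def)
  have \<phi>_nonneg: "0 \<le> \<phi> t" if "0 \<le> t" "t < 1" for t
  proof -
    have "p holomorphic_on ball 0 (norm z)"
      using hol by (rule holomorphic_on_subset) (use z in auto)
    from positive_real_part_lower_bound[OF this p0 pos that, of "of_real t * z"]
    show ?thesis
      using z that by (simp add: \<phi>_def norm_mult cmod_power2)
  qed
  have "4 * Re (z * deriv p z) + 2 * (1 + (Im (p z))\<^sup>2) \<le> 0"
  proof (rule ccontr)
    assume "\<not> ?thesis"
    then obtain d where d: "d > 0" "\<And>s. 0 < s \<Longrightarrow> s < d \<Longrightarrow> \<phi> (1 - s) < \<phi> 1"
      using DERIV_pos_inc_left[OF \<phi>'] by auto
    define s where "s = min (d / 2) 1"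
    have "0 < s" "s < d" "s \<le> 1"
      using d(1) by (auto simp: s_def)
    then show False
      using d(2)[of s] \<phi>_nonneg[of "1 - s"] \<phi>1 by simp
  qed
  then show ?thesis
    using z(3) by (simp add: cmod_power2)
qed

section \<open>The three quotients in terms of each other\<close>

text \<open>
  The shape that the Schwarzian term takes at a contact point: \<open>P = Q_ST\<close>, and \<open>T\<close> is either \<open>Q_ST\<close> or
  \<open>Q_CV\<close>. As \<open>c / T\<close> is imaginary, only \<open>V / (P T)\<close> counts, and \<open>P T\<close> is a negative number.
\<close>
lemma Re_divide_imaginary_nonneg:
  assumes V: "Re V \<le> 0" and P: "Re P = 0" "P \<noteq> 0" and T: "Re T = 0" "T \<noteq> 0"
    and PT: "Re (P * T) \<le> 0" and c: "c \<in> \<real>"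
  shows "0 \<le> Re ((c + V / P) / T)"
proof -
  obtain c' where c': "c = of_real c'"
    using c by (rule Reals_cases)
  obtain s t where s: "P = \<i> * of_real s" and t: "T = \<i> * of_real t"
    using P T by (metis complex_eq mult_zero_right add_0 of_real_0)
  have st: "0 \<le> s * t" "s \<noteq> 0" "t \<noteq> 0"
    using PT P T by (auto simp: s t)
  have "(c + V / P) / T = of_real (c' / t) / \<i> - V / of_real (s * t)"
    using st by (simp add: c' s t divide_simps)
  then have "Re ((c + V / P) / T) = - Re V / (s * t)"
    by (simp add: Re_divide_of_real del: of_real_mult of_real_divide)
  then show ?thesis
    using V st by (simp add: divide_nonpos_nonneg)
qed

lemma holomorphic_Q_ST:
  assumes hol: "f holomorphic_on unit_disc" and f: "f 0 = 0" "deriv f 0 = 1"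
    and nz: "\<And>z. z \<in> unit_disc \<Longrightarrow> z \<noteq> 0 \<Longrightarrow> f z \<noteq> 0"
  shows "Q_ST f holomorphic_on unit_disc"
proof -
  \<comment> \<open>Cancelling one factor \<open>z\<close> turns the quotient into one with a nonvanishing holomorphic denominator.\<close>
  define g where "g = (\<lambda>z. if z = 0 then deriv f 0 else (f z - f 0) / (z - 0))"
  have "g holomorphic_on unit_disc"
    unfolding g_def by (rule pole_lemma[OF hol]) simp
  moreover have "g z \<noteq> 0" if "z \<in> unit_disc" for z
    using nz[OF that] f by (simp add: g_def)
  ultimately have "(\<lambda>z. deriv f z / g z) holomorphic_on unit_disc"
    by (intro holomorphic_intros holomorphic_deriv hol) auto
  then show ?thesis
    by (rule holomorphic_transform) (auto simp: Q_ST_def g_def f)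
qed

text \<open>Logarithmic differentiation of \<open>Q_ST f = z f' / f\<close>.\<close>
lemma Q_CV_eq_Q_ST:
  assumes hol: "f holomorphic_on S" and S: "open S" "z \<in> S"
    and nz: "z \<noteq> 0" "f z \<noteq> 0" "deriv f z \<noteq> 0"
  shows "Q_CV f z = Q_ST f z + z * deriv (Q_ST f) z / Q_ST f z"
proof -
  have f': "(f has_field_derivative deriv f z) (at z)"
    using hol S by (rule holomorphic_derivI)
  have f'': "(deriv f has_field_derivative deriv (deriv f) z) (at z)"
    using holomorphic_deriv[OF hol S(1)] S by (rule holomorphic_derivI)
  have "((\<lambda>w. w * deriv f w / f w) has_field_derivative
      ((deriv f z + z * deriv (deriv f) z) * f z - z * deriv f z * deriv f z) / (f z * f z)) (at z)"
    by (rule derivative_eq_intros f' f'' refl nz)+ (simp add: algebra_simps)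
  then have "(Q_ST f has_field_derivative
      ((deriv f z + z * deriv (deriv f) z) * f z - z * deriv f z * deriv f z) / (f z * f z)) (at z)"
    by (rule DERIV_cong_ev[OF refl _ refl, THEN iffD2, rotated])
       (use eventually_neq_at_within[of z 0] t1_space_nhds[OF nz(1)] in \<open>auto simp: Q_ST_def elim: eventually_mono\<close>)
  then have "deriv (Q_ST f) z =
      ((deriv f z + z * deriv (deriv f) z) * f z - z * deriv f z * deriv f z) / (f z * f z)"
    by (rule DERIV_imp_deriv)
  then show ?thesis
    using nz by (simp add: Q_CV_def Q_ST_def field_simps)
qed

text \<open>
  With \<open>n = f'' / f'\<close> and \<open>Q_CV f = 1 + z n\<close>, the terms of \<open>z\<^sup>2 (n' - n\<^sup>2 / 2)\<close> regroup by completing the square.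
\<close>
lemma Q_SD_eq_Q_CV:
  assumes hol: "f holomorphic_on S" and S: "open S" "z \<in> S" and nz: "deriv f z \<noteq> 0"
  shows "Q_SD f z = z * deriv (Q_CV f) z + (1 - (Q_CV f z)\<^sup>2) / 2"
proof -
  define n where "n = (\<lambda>w. deriv (deriv f) w / deriv f w)"
  have hol': "deriv f holomorphic_on S"
    using hol S(1) by (rule holomorphic_deriv)
  have hol'': "deriv (deriv f) holomorphic_on S"
    using hol' S(1) by (rule holomorphic_deriv)
  have "n field_differentiable (at z)"
    unfolding n_def using hol' hol'' S nz
    by (intro field_differentiable_divide) (auto simp: holomorphic_on_open field_differentiable_def)
  then have n': "(n has_field_derivative deriv n z) (at z)"
    by (simp add: DERIV_deriv_iff_field_differentiable)
  have "Q_CV f = (\<lambda>w. 1 + w * n w)"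
    by (auto simp: Q_CV_def n_def)
  moreover have "((\<lambda>w. 1 + w * n w) has_field_derivative n z + z * deriv n z) (at z)"
    by (rule derivative_eq_intros n' refl)+ simp
  ultimately show ?thesis
    by (simp add: Q_SD_def DERIV_imp_deriv power2_eq_square field_simps flip: n_def fun_cong[OF n_def])
qed

text \<open>
  Differentiating \<open>Q_CV_eq_Q_ST\<close>. The result is grouped so that at a contact point the first and the last
  term are real and all of the second derivative sits in the middle one.
\<close>
lemma deriv_Q_CV:
  assumes hol: "f holomorphic_on unit_disc" and f: "f 0 = 0" "deriv f 0 = 1"
    and nz: "\<And>z. z \<in> unit_disc \<Longrightarrow> z \<noteq> 0 \<Longrightarrow> f z \<noteq> 0 \<and> deriv f z \<noteq> 0"
    and z: "z \<in> unit_disc" "z \<noteq> 0"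
  shows "z * deriv (Q_CV f) z = z * deriv (Q_ST f) z
    + (z * deriv (Q_ST f) z + z\<^sup>2 * deriv (deriv (Q_ST f)) z) / Q_ST f z
    - (z * deriv (Q_ST f) z)\<^sup>2 / (Q_ST f z)\<^sup>2"
proof -
  let ?p = "Q_ST f"
  have hol_p: "?p holomorphic_on unit_disc"
    using hol f nz by (intro holomorphic_Q_ST) auto
  have pz: "?p z \<noteq> 0"
    using nz[OF z] z by (simp add: Q_ST_def)
  have p': "(?p has_field_derivative deriv ?p z) (at z)"
    using hol_p open_ball z(1) by (rule holomorphic_derivI)
  have p'': "(deriv ?p has_field_derivative deriv (deriv ?p) z) (at z)"
    using holomorphic_deriv[OF hol_p open_ball] open_ball z(1) by (rule holomorphic_derivI)
  have "((\<lambda>w. ?p w + w * deriv ?p w / ?p w) has_field_derivative deriv ?p z +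
      ((deriv ?p z + z * deriv (deriv ?p) z) * ?p z - z * deriv ?p z * deriv ?p z) / (?p z * ?p z)) (at z)"
    by (rule derivative_eq_intros p' p'' refl pz)+ (simp add: algebra_simps)
  moreover have Q_CV: "\<forall>\<^sub>F w in nhds z. Q_CV f w = ?p w + w * deriv ?p w / ?p w"
  proof -
    have "\<forall>\<^sub>F w in nhds z. w \<in> unit_disc - {0}"
      using z by (intro eventually_nhds_in_open) auto
    then show ?thesis
      by eventually_elim (use Q_CV_eq_Q_ST[OF hol open_ball] nz in auto)
  qed
  ultimately have q': "deriv (Q_CV f) z = deriv ?p z +
      ((deriv ?p z + z * deriv (deriv ?p) z) * ?p z - z * deriv ?p z * deriv ?p z) / (?p z * ?p z)"
    by (intro DERIV_imp_deriv) (simp add: DERIV_cong_ev[OF refl Q_CV refl])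
  show ?thesis
    unfolding q' using pz by (simp add: power2_eq_square field_simps)
qed

section \<open>The contradiction at the contact point\<close>

text \<open>
  If \<open>f\<close> is not starlike, then some point carries exactly the values that all four inequalities exclude.
  There \<open>Q_ST\<close> and \<open>Q_CV\<close> are imaginary with product at most \<open>- 1 / 2\<close>: with \<open>Q_ST = \<i> x\<close> the product is
  \<open>Y - x\<^sup>2 \<le> - (1 + x\<^sup>2) / 2 - x\<^sup>2\<close>.
\<close>
lemma contact_point_values:
  fixes \<alpha> \<beta> :: real
  assumes hol: "f holomorphic_on unit_disc" and f: "f 0 = 0" "deriv f 0 = 1"
    and nz: "\<And>z. z \<in> unit_disc \<Longrightarrow> z \<noteq> 0 \<Longrightarrow> f z \<noteq> 0 \<and> deriv f z \<noteq> 0"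
    and not_pos: "z\<^sub>1 \<in> unit_disc" "Re (Q_ST f z\<^sub>1) \<le> 0"
  obtains z where "z \<in> unit_disc" and "Re (Q_ST f z) = 0" and "Re (Q_CV f z) = 0"
    and "Re (Q_ST f z * Q_CV f z) \<le> - 1 / 2"
    and "0 \<le> Re (Q_SD f z / Q_ST f z)" and "0 \<le> Re (Q_SD f z / Q_CV f z)"
proof -
  let ?p = "Q_ST f" and ?q = "Q_CV f"
  have hol_p: "?p holomorphic_on unit_disc"
    using hol f nz by (intro holomorphic_Q_ST) auto
  have p0: "?p 0 = 1"
    by (simp add: Q_ST_def)
  obtain z where z: "norm z < 1" "z \<noteq> 0" "Re (?p z) = 0"
    and pos: "\<And>\<zeta>. norm \<zeta> < norm z \<Longrightarrow> 0 < Re (?p \<zeta>)"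
    and nonneg: "\<And>\<zeta>. norm \<zeta> = norm z \<Longrightarrow> 0 \<le> Re (?p \<zeta>)"
    using first_boundary_contact[OF hol_p p0, of z\<^sub>1] not_pos by auto
  define Y where "Y = z * deriv ?p z"
  define V where "V = Y + z\<^sup>2 * deriv (deriv ?p) z"
  have zD: "z \<in> unit_disc"
    using z by simp
  have "sphere 0 (norm z) \<subseteq> unit_disc"
    using z(1) by auto
  then have "Im Y = 0" and V: "Re V \<le> 0"
    unfolding Y_def V_def using Re_minimal_on_circle[OF hol_p open_ball, of z] nonneg z(3) by simp_all
  then obtain y where y: "Y = of_real y"
    by (metis complex_is_Real_iff Reals_cases)
  obtain x where x: "?p z = \<i> * of_real x"
    using z(3) by (metis complex_eq add_0 of_real_0)
  have pz: "?p z \<noteq> 0"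
    using nz[OF zD z(2)] z by (simp add: Q_ST_def)
  then have x0: "x \<noteq> 0"
    by (simp add: x)
  have y_le: "2 * y \<le> - (1 + x\<^sup>2)"
    using radial_derivative_at_contact[OF hol_p p0 z pos] by (simp add: y x norm_mult flip: Y_def)
  have q: "?q z = ?p z + Y / ?p z"
    using Q_CV_eq_Q_ST[OF hol open_ball zD] nz[OF zD z(2)] z by (simp add: Y_def)
  have q_im: "?q z = \<i> * of_real (x - y / x)"
    using x0 by (simp add: q x y field_simps)
  have pq: "?p z * ?q z = of_real (y - x\<^sup>2)"
    using pz by (simp add: q distrib_left x y power_mult_distrib flip: power2_eq_square)
  have pq_le: "y - x\<^sup>2 \<le> - 1 / 2"
    using y_le zero_le_power2[of x] by linarith
  have q0: "?q z \<noteq> 0"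
    using arg_cong[OF pq, of Re] pq_le by auto
  \<comment> \<open>The part of \<open>Q_SD\<close> that is real because \<open>Y\<close> is real and \<open>Q_ST\<close>, \<open>Q_CV\<close> are imaginary.\<close>
  define c where "c = Y - Y\<^sup>2 / (?p z)\<^sup>2 + (1 - (?q z)\<^sup>2) / 2"
  have c: "c \<in> \<real>"
    unfolding c_def y x q_im by (simp add: power_mult_distrib)
  have SD: "Q_SD f z = c + V / ?p z"
    using Q_SD_eq_Q_CV[OF hol open_ball zD] nz[OF zD z(2)] deriv_Q_CV[OF hol f nz zD z(2)]
    by (simp add: c_def V_def Y_def)
  have "0 \<le> Re (Q_SD f z / ?p z)"
    unfolding SD using V pz c x by (intro Re_divide_imaginary_nonneg) auto
  moreover have "0 \<le> Re (Q_SD f z / ?q z)"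
    unfolding SD using V pz c x q0 pq pq_le q_im
    by (intro Re_divide_imaginary_nonneg) auto
  moreover have "Re (?q z) = 0" and "Re (?p z * ?q z) \<le> - 1 / 2"
    unfolding pq using pq_le by (simp_all add: q_im)
  ultimately show thesis
    using that zD z(3) by blast
qed

theorem theorem2p17:
  fixes \<alpha> \<beta> :: real and f :: "complex \<Rightarrow> complex"
  assumes "\<alpha> \<le> 0" and "\<beta> \<ge> 0"
    and "f \<in> class_A"
    and "\<forall>z\<in>unit_disc. f_f'_over_z f z \<noteq> 0"
    and "(\<forall>z\<in>unit_disc. Q_ST f z \<noteq> 0 \<and>
            Re (of_real \<alpha> * (Q_SD f z / Q_ST f z) + Q_ST f z * (1 + of_real \<beta> * Q_CV f z)) > - \<beta> / 2) \<or>
         (\<forall>z\<in>unit_disc. Q_ST f z \<noteq> 0 \<and>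
            Re (of_real \<alpha> * (Q_SD f z / Q_ST f z) + Q_CV f z * (1 + of_real \<beta> * Q_ST f z)) > - \<beta> / 2) \<or>
         (\<forall>z\<in>unit_disc. Q_CV f z \<noteq> 0 \<and>
            Re (of_real \<alpha> * (Q_SD f z / Q_CV f z) + Q_CV f z * (1 + of_real \<beta> * Q_ST f z)) > - \<beta> / 2) \<or>
         (\<forall>z\<in>unit_disc. Q_CV f z \<noteq> 0 \<and>
            Re (of_real \<alpha> * (Q_SD f z / Q_CV f z) + Q_ST f z * (1 + of_real \<beta> * Q_CV f z)) > - \<beta> / 2)"
  shows "starlike_function f"
proof -
  have hol: "f holomorphic_on unit_disc" and f: "f 0 = 0" "deriv f 0 = 1"
    using assms(3) by (auto simp: class_A_def)
  have nz: "f z \<noteq> 0 \<and> deriv f z \<noteq> 0" if "z \<in> unit_disc" "z \<noteq> 0" for z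
    using bspec[OF assms(4) that(1)] that(2) by (auto simp: f_f'_over_z_def)
  have "0 < Re (Q_ST f z\<^sub>1)" if z\<^sub>1: "z\<^sub>1 \<in> unit_disc" for z\<^sub>1
  proof (rule ccontr)
    assume "\<not> 0 < Re (Q_ST f z\<^sub>1)"
    then obtain z where z: "z \<in> unit_disc" and ST: "Re (Q_ST f z) = 0" and CV: "Re (Q_CV f z) = 0"
      and ST_CV: "Re (Q_ST f z * Q_CV f z) \<le> - 1 / 2"
      and SD: "0 \<le> Re (Q_SD f z / Q_ST f z)" "0 \<le> Re (Q_SD f z / Q_CV f z)"
      using contact_point_values[OF hol f nz z\<^sub>1] by (metis not_le)
    have Schwarzian_term: "Re (of_real \<alpha> * w) \<le> 0" if "0 \<le> Re w" for w
      using that assms(1) by (simp add: mult_nonpos_nonneg)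
    have mixed: "Re (u * (1 + of_real \<beta> * v)) \<le> - \<beta> / 2"
      if "Re u = 0" "Re (u * v) \<le> - 1 / 2" for u v
    proof -
      have "Re (u * (1 + of_real \<beta> * v)) = Re u + \<beta> * Re (u * v)"
        by (simp add: algebra_simps)
      also have "\<dots> \<le> - \<beta> / 2"
        using that mult_left_mono[OF that(2) assms(2)] by simp
      finally show ?thesis .
    qed
    have "Re (Q_ST f z * (1 + of_real \<beta> * Q_CV f z)) \<le> - \<beta> / 2"
      and "Re (Q_CV f z * (1 + of_real \<beta> * Q_ST f z)) \<le> - \<beta> / 2"
      using mixed ST CV ST_CV by (auto simp: mult.commute)
    then show False
      using assms(5) z Schwarzian_term[OF SD(1)] Schwarzian_term[OF SD(2)] by fastforce
  qed
  then show ?thesis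
    using assms(3) by (simp add: starlike_function_def)
qed

end
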